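(* Let $\alpha=(\alpha_n)_{n\in\mathbb{N}}$ and $\beta=(\beta_n)_{n\in\mathbb{N}}$ be increasing sequences tending to infinity. If $\alpha$ or $\beta$ is stable, then the pair $(\Lambda_\infty(\alpha),\Lambda_0(\beta))$ is not tame.
   Context: For an increasing sequence $\alpha=(\alpha_n)$ tending to infinity, the power series spaces of infinite and finite type are $\Lambda_\infty(\alpha)=\{x=(x_n):\ \|x\|_k=\sum_{n}|x_n|e^{k\alpha_n}<\infty\text{ for all }k\in\mathbb{N}\}$ and $\Lambda_0(\alpha)=\{x=(x_n):\ \|x\|_k=\sum_{n}|x_n|e^{-\alpha_n/k}<\infty\text{ for all }k\in\mathbb{N}\}$ ($\mathbb{N}=\{1,2,\dots\}$), Fréchet spaces graded by the norms $\|\cdot\|_k$. The sequence $\alpha$ is stable if $\sup_{j}\alpha_{j+1}/\alpha_j<\infty$. For Fréchet spaces $E,F$ with increasing sequences of seminorms $(\|\cdot\|_k)$ and a continuous linear operator $T:E\to F$, put $\pi_T(k)=\inf\{r\in\mathbb{N}:\ \sup_{\|x\|_r\le1}\|Tx\|_k<\infty\}$. The pair $(E,F)$ is tame if there exists a non-decreasing function $S:\mathbb{N}\to\mathbb{N}$ such that for every continuous linear operator $T:E\to F$ one has $\pi_T(k)\le S(k)$ for all sufficiently large $k$. *)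

theory Defs
  imports "HOL-Analysis.Analysis" "HOL-Library.Function_Algebras"
begin

text \<open>
  A vector space over the scalars \<open>'k\<close>, given as a subset of a type, with a sequence of seminorms.
  Gradings are indexed by the positive integers: \<open>gseminorm E 0\<close> is never used.
\<close>

record ('k, 'v) graded_space =
  gcarrier :: "'v set"
  gscale :: "'k \<Rightarrow> 'v \<Rightarrow> 'v"
  gseminorm :: "nat \<Rightarrow> 'v \<Rightarrow> real"

text \<open>The locally convex topology defined by the seminorms; the semiballs form a subbasis.\<close>

definition gtopology :: "('k, 'v::ab_group_add) graded_space \<Rightarrow> 'v topology" where
  "gtopology E = topology_generated_by
     {{y \<in> gcarrier E. gseminorm E k (y - x) < e} | x k e. x \<in> gcarrier E \<and> 1 \<le> k \<and> 0 < e}"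

definition glinear ::
  "('k, 'v::ab_group_add) graded_space \<Rightarrow> ('k, 'w::ab_group_add) graded_space \<Rightarrow> ('v \<Rightarrow> 'w) \<Rightarrow> bool"
where
  "glinear E F T \<longleftrightarrow>
     (\<forall>x\<in>gcarrier E. \<forall>y\<in>gcarrier E. T (x + y) = T x + T y) \<and>
     (\<forall>c. \<forall>x\<in>gcarrier E. T (gscale E c x) = gscale F c (T x))"

definition continuous_linear_operator ::
  "('k, 'v::ab_group_add) graded_space \<Rightarrow> ('k, 'w::ab_group_add) graded_space \<Rightarrow> ('v \<Rightarrow> 'w) \<Rightarrow> bool"
where
  "continuous_linear_operator E F T \<longleftrightarrow>
     glinear E F T \<and> continuous_map (gtopology E) (gtopology F) T"

text \<open>
  The characteristic \<open>\<pi>\<^sub>T\<close> is valued in \<open>enat\<close> so that the infimum of the empty set is \<open>\<infinity>\<close>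
  (on \<open>nat\<close> it would be \<open>0\<close>).
\<close>

definition char_of_continuity ::
  "('k, 'v) graded_space \<Rightarrow> ('k, 'w) graded_space \<Rightarrow> ('v \<Rightarrow> 'w) \<Rightarrow> nat \<Rightarrow> enat"
where
  "char_of_continuity E F T k =
     (INF r \<in> {r. 1 \<le> r \<and>
        bdd_above ((\<lambda>x. gseminorm F k (T x)) ` {x \<in> gcarrier E. gseminorm E r x \<le> 1})}. enat r)"

definition tame_pair ::
  "('k, 'v::ab_group_add) graded_space \<Rightarrow> ('k, 'w::ab_group_add) graded_space \<Rightarrow> bool"
where
  "tame_pair E F \<longleftrightarrow>
     (\<exists>S :: nat \<Rightarrow> nat. S ` {1..} \<subseteq> {1..} \<and> mono_on {1..} S \<and>
        (\<forall>T. continuous_linear_operator E F T \<longrightarrow>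
           (\<forall>\<^sub>F k in sequentially. char_of_continuity E F T k \<le> enat (S k))))"

text \<open>
  Sequences are indexed from \<open>0\<close>, which is only a relabelling. The scalar field \<open>'k\<close> is a complete
  real normed field, that is, the real or the complex numbers.
\<close>

definition power_series_infinite ::
  "(nat \<Rightarrow> real) \<Rightarrow> ('k::{real_normed_field,banach}, nat \<Rightarrow> 'k) graded_space"
where
  "power_series_infinite \<alpha> =
     \<lparr>gcarrier = {x. \<forall>k\<ge>1. summable (\<lambda>n. norm (x n) * exp (real k * \<alpha> n))},
      gscale = (\<lambda>c x n. c * x n),
      gseminorm = (\<lambda>k x. \<Sum>n. norm (x n) * exp (real k * \<alpha> n))\<rparr>"

definition power_series_finite ::
  "(nat \<Rightarrow> real) \<Rightarrow> ('k::{real_normed_field,banach}, nat \<Rightarrow> 'k) graded_space"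
where
  "power_series_finite \<alpha> =
     \<lparr>gcarrier = {x. \<forall>k\<ge>1. summable (\<lambda>n. norm (x n) * exp (- \<alpha> n / real k))},
      gscale = (\<lambda>c x n. c * x n),
      gseminorm = (\<lambda>k x. \<Sum>n. norm (x n) * exp (- \<alpha> n / real k))\<rparr>"

text \<open>
  For an increasing sequence tending to infinity only finitely many terms are \<open>\<le> 0\<close>, so the
  convention \<open>x / 0 = 0\<close> does not influence boundedness of the quotients.
\<close>

definition stable_seq :: "(nat \<Rightarrow> real) \<Rightarrow> bool" where
  "stable_seq \<alpha> \<longleftrightarrow> bdd_above (range (\<lambda>j. \<alpha> (Suc j) / \<alpha> j))"

end

theory Submission
  imports Defs
begin

text \<open>
  Given a candidate \<open>S\<close>, take an operator sending \<open>e\<^bsub>N j\<^esub>\<close> to \<open>exp (t j) e\<^bsub>I j\<^esub>\<close>, where each \<open>k \<ge> 1\<close>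
  is attached to infinitely many indices \<open>j\<close> and
  \<open>t j = (S k + 1) \<alpha>\<^bsub>N j\<^esub> + \<beta>\<^bsub>I j\<^esub> / k\<close> there. Then the \<open>k\<close>-th seminorm is not controlled by the
  \<open>S k\<close>-th one. For the \<open>m\<close>-th seminorm, the indices attached to some \<open>k > m\<close> do no harm as soon as
  \<open>\<beta>\<^bsub>I j\<^esub> \<ge> k\<^sup>2 (S k + 1) \<alpha>\<^bsub>N j\<^esub>\<close>, and the finitely many \<open>k \<le> m\<close> do no harm as long as
  \<open>\<beta>\<^bsub>I j\<^esub> / \<alpha>\<^bsub>N j\<^esub>\<close> is bounded for each \<open>k\<close>. Stability of one of the sequences provides pairs
  \<open>(N j, I j)\<close> with both properties.
\<close>

section \<open>Stability and pairs of comparable terms\<close>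

text \<open>The first term that reaches y has a predecessor below y, so stability keeps it below C
  y. The index can be pushed beyond any M because y is taken large after M.\<close>

lemma stable_seq_approximates:
  assumes "incseq b" and lim: "filterlim b at_top sequentially" and "stable_seq b"
  shows "\<exists>C\<ge>1. \<forall>M. \<forall>\<^sub>F y in at_top. \<exists>i\<ge>M. y \<le> b i \<and> b i \<le> C * y"
proof -
  obtain C0 where C0: "b (Suc j) / b j \<le> C0" for j
    using assms(3) unfolding stable_seq_def bdd_above_def by auto
  define C where "C = max C0 1"
  obtain n0 where n0: "b j \<ge> 1" if "j \<ge> n0" for j
    using lim unfolding filterlim_at_top eventually_sequentially by blast
  \<comment> \<open>Above this threshold the least index reaching y exceeds both \<open>n0\<close>
    and \<open>M\<close>; it is then a successor whose predecessor has a positive term, so the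
    quotient can be multiplied out.\<close>
  have "\<exists>i\<ge>M. y \<le> b i \<and> b i \<le> C * y" if y: "y > b (max n0 M)" for y M
  proof -
    have ex: "\<exists>i. y \<le> b i"
      using lim unfolding filterlim_at_top eventually_sequentially by blast
    define i where "i = (LEAST i. y \<le> b i)"
    have yi: "y \<le> b i"
      unfolding i_def using ex by (rule LeastI_ex)
    have "max n0 M < i"
      using y yi incseqD[OF assms(1), of i "max n0 M"] by (meson leD leI order_trans)
    then obtain j where j: "i = Suc j" "n0 \<le> j" "M \<le> j"
      by (cases i) auto
    have "b j < y"
      using not_less_Least[of j "\<lambda>i. y \<le> b i"] j(1) unfolding i_def by auto
    moreover have "b (Suc j) \<le> C0 * b j"
      using C0[of j] n0[OF j(2)] by (simp add: field_simps)
    moreover have "C0 * b j \<le> C * b j"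
      using n0[OF j(2)] by (intro mult_right_mono) (auto simp: C_def)
    moreover have "C * b j \<le> C * y"
      using \<open>b j < y\<close> by (intro mult_left_mono) (auto simp: C_def)
    ultimately have "b i \<le> C * y"
      unfolding j(1) by linarith
    with yi j show ?thesis
      by (intro exI[of _ i]) auto
  qed
  then have "\<forall>M. \<forall>\<^sub>F y in at_top. \<exists>i\<ge>M. y \<le> b i \<and> b i \<le> C * y"
    by (intro allI eventually_mono[OF eventually_gt_at_top])
  then show ?thesis
    by (intro exI[of _ C]) (auto simp: C_def)
qed

text \<open>Whichever sequence is stable is used to approximate a multiple of the other. It matters
  that B is fixed before M: one bound serves infinitely many pairs.\<close>

lemma comparable_pairs:
  fixes \<alpha> \<beta> :: "nat \<Rightarrow> real"
  assumes "incseq \<alpha>" and \<alpha>: "filterlim \<alpha> at_top sequentially"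
    and "incseq \<beta>" and \<beta>: "filterlim \<beta> at_top sequentially"
    and "stable_seq \<alpha> \<or> stable_seq \<beta>" and "A > 0"
  shows "\<exists>B. \<forall>M. \<exists>n\<ge>M. \<exists>i\<ge>M. A * \<alpha> n \<le> \<beta> i \<and> \<beta> i \<le> B * \<alpha> n"
  using assms(5)
proof
  assume "stable_seq \<beta>"
  then obtain C where C: "\<forall>M. \<forall>\<^sub>F y in at_top. \<exists>i\<ge>M. y \<le> \<beta> i \<and> \<beta> i \<le> C * y"
    using stable_seq_approximates[OF assms(3) \<beta>] by blast
  have lim: "filterlim (\<lambda>n. A * \<alpha> n) at_top sequentially"
    using \<open>A > 0\<close> \<alpha> by (intro filterlim_tendsto_pos_mult_at_top[OF tendsto_const])
  have "\<exists>n\<ge>M. \<exists>i\<ge>M. A * \<alpha> n \<le> \<beta> i \<and> \<beta> i \<le> (C * A) * \<alpha> n" for M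
  proof -
    have "\<forall>\<^sub>F n in sequentially. \<exists>i\<ge>M. A * \<alpha> n \<le> \<beta> i \<and> \<beta> i \<le> C * (A * \<alpha> n)"
      using C lim unfolding filterlim_iff by blast
    then have "\<forall>\<^sub>F n in sequentially. n \<ge> M \<and> (\<exists>i\<ge>M. A * \<alpha> n \<le> \<beta> i \<and> \<beta> i \<le> C * (A * \<alpha> n))"
      using eventually_ge_at_top by (rule eventually_conj[rotated])
    then show ?thesis
      by (auto dest!: eventually_happens simp: mult.assoc)
  qed
  then show ?thesis by blast
next
  assume "stable_seq \<alpha>"
  then obtain C where "C \<ge> 1"
    and C: "\<forall>M. \<forall>\<^sub>F y in at_top. \<exists>n\<ge>M. y \<le> \<alpha> n \<and> \<alpha> n \<le> C * y"
    using stable_seq_approximates[OF assms(1) \<alpha>] by blast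
  \<comment> \<open>The target \<beta>_i / (A C) leaves room for the factor C: overshooting it by at
    most C still gives \<alpha>_n \<le> \<beta>_i / A.\<close>
  have lim: "filterlim (\<lambda>i. inverse (A * C) * \<beta> i) at_top sequentially"
    using \<open>A > 0\<close> \<open>C \<ge> 1\<close> \<beta> by (intro filterlim_tendsto_pos_mult_at_top[OF tendsto_const]) auto
  have "\<exists>n\<ge>M. \<exists>i\<ge>M. A * \<alpha> n \<le> \<beta> i \<and> \<beta> i \<le> (A * C) * \<alpha> n" for M
  proof -
    have "\<forall>\<^sub>F i in sequentially. \<exists>n\<ge>M. inverse (A * C) * \<beta> i \<le> \<alpha> n \<and>
        \<alpha> n \<le> C * (inverse (A * C) * \<beta> i)"
      using C lim unfolding filterlim_iff by blast
    then have "\<forall>\<^sub>F i in sequentially. i \<ge> M \<and> (\<exists>n\<ge>M. inverse (A * C) * \<beta> i \<le> \<alpha> n \<and>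
        \<alpha> n \<le> C * (inverse (A * C) * \<beta> i))"
      using eventually_ge_at_top by (rule eventually_conj[rotated])
    then obtain i n where "i \<ge> M" "n \<ge> M" "inverse (A * C) * \<beta> i \<le> \<alpha> n"
        "\<alpha> n \<le> C * (inverse (A * C) * \<beta> i)"
      by (auto dest!: eventually_happens)
    with \<open>A > 0\<close> \<open>C \<ge> 1\<close> show ?thesis
      by (intro exI[of _ n] exI[of _ i] conjI) (auto simp: field_simps)
  qed
  then show ?thesis by blast
qed

section \<open>Choice of the indices and exponents\<close>

text \<open>For the operator sending e_(N j) to exp(t j) e_(I j), the upper bound on t compares the
  m-th seminorm of the image with the r-th seminorm of e_(N j), with constant 1. The equation for t
  makes the analogous ratio for k and S k equal to exp(\<alpha>_(N j)), which is unbounded.\<close>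

lemma exponents_with_prescribed_growth:
  fixes \<alpha> \<beta> :: "nat \<Rightarrow> real" and S :: "nat \<Rightarrow> nat"
  assumes "incseq \<alpha>" and \<alpha>: "filterlim \<alpha> at_top sequentially"
    and "incseq \<beta>" and \<beta>: "filterlim \<beta> at_top sequentially"
    and "stable_seq \<alpha> \<or> stable_seq \<beta>"
  obtains N I :: "nat \<Rightarrow> nat" and t :: "nat \<Rightarrow> real"
  where "strict_mono N" and "strict_mono I"
    and "\<forall>m\<ge>1. \<exists>r\<ge>1. \<forall>j. t j \<le> real r * \<alpha> (N j) + \<beta> (I j) / real m"
    and "\<forall>k\<ge>1. \<forall>M. \<exists>j. M \<le> \<alpha> (N j) \<and> 0 \<le> \<alpha> (N j) \<and>
           t j = (real (S k) + 1) * \<alpha> (N j) + \<beta> (I j) / real k"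
proof -
  \<comment> \<open>The square comes from 1/m - 1/k \<ge> 1/k^2 for 1 \<le> m < k: the part
    \<beta>/k^2 has to absorb (S k + 1) \<alpha>.\<close>
  define A where "A k = (real k)\<^sup>2 * (real (S k) + 1)" for k
  have "\<exists>B. \<forall>M. \<exists>n\<ge>M. \<exists>i\<ge>M. A k * \<alpha> n \<le> \<beta> i \<and> \<beta> i \<le> B * \<alpha> n" if "k \<ge> 1" for k
    using that by (intro comparable_pairs assms) (auto simp: A_def)
  then obtain B where B: "\<exists>n\<ge>M. \<exists>i\<ge>M. A k * \<alpha> n \<le> \<beta> i \<and> \<beta> i \<le> B k * \<alpha> n"
    if "k \<ge> 1" for k M
    by metis
  \<comment> \<open>The first component of the decoded pair takes every value infinitely often;
    \<open>Suc\<close> moves the values to the positive integers.\<close>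
  define \<kappa> where "\<kappa> j = Suc (fst (prod_decode j))" for j
  define P where "P j p \<longleftrightarrow> real j \<le> \<alpha> (fst p) \<and> A (\<kappa> j) * \<alpha> (fst p) \<le> \<beta> (snd p) \<and>
    \<beta> (snd p) \<le> B (\<kappa> j) * \<alpha> (fst p)" for j and p :: "nat \<times> nat"
  have ex: "\<exists>p. P j p \<and> fst p \<ge> M \<and> snd p \<ge> M" for j M
  proof -
    obtain n0 where n0: "\<alpha> n \<ge> real j" if "n \<ge> n0" for n
      using \<alpha> unfolding filterlim_at_top eventually_sequentially by blast
    obtain n i where "n \<ge> max n0 M" "i \<ge> max n0 M" "A (\<kappa> j) * \<alpha> n \<le> \<beta> i" "\<beta> i \<le> B (\<kappa> j) * \<alpha> n"
      using B[of "\<kappa> j" "max n0 M"] by (auto simp: \<kappa>_def)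
    then show ?thesis
      using n0[of n] by (intro exI[of _ "(n, i)"]) (auto simp: P_def)
  qed
  \<comment> \<open>Choosing the pairs one after another makes both index sequences strictly
    increasing, hence injective.\<close>
  have "\<exists>f. \<forall>j. P j (f j) \<and> (fst (f j) < fst (f (Suc j)) \<and> snd (f j) < snd (f (Suc j)))"
  proof (rule dependent_nat_choice)
    show "\<exists>p. P 0 p" using ex by blast
  next
    fix p j
    show "\<exists>q. P (Suc j) q \<and> (fst p < fst q \<and> snd p < snd q)"
      using ex[of "Suc j" "Suc (max (fst p) (snd p))"] by (auto simp: Suc_le_eq)
  qed
  then obtain f where f: "\<And>j. P j (f j)" "\<And>j. fst (f j) < fst (f (Suc j))"
      "\<And>j. snd (f j) < snd (f (Suc j))"
    by blast
  define N I where "N j = fst (f j)" and "I j = snd (f j)" for j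
  define t where "t j = (real (S (\<kappa> j)) + 1) * \<alpha> (N j) + \<beta> (I j) / real (\<kappa> j)" for j
  have \<alpha>_ge: "real j \<le> \<alpha> (N j)" and A: "A (\<kappa> j) * \<alpha> (N j) \<le> \<beta> (I j)"
      and B: "\<beta> (I j) \<le> B (\<kappa> j) * \<alpha> (N j)" for j
    using f(1)[of j] by (simp_all add: P_def N_def I_def)
  have \<alpha>_nonneg: "0 \<le> \<alpha> (N j)" for j
    using \<alpha>_ge[of j] of_nat_0_le_iff order_trans by blast
  have \<kappa>_pos: "\<kappa> j \<ge> 1" for j by (simp add: \<kappa>_def)
  have \<beta>_nonneg: "0 \<le> \<beta> (I j)" for j
    using A[of j] \<alpha>_nonneg[of j] by (smt (verit) A_def mult_nonneg_nonneg of_nat_0_le_iff zero_le_power2)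
  show thesis
  proof (rule that)
    show "strict_mono N" "strict_mono I"
      using f by (simp_all add: strict_mono_Suc_iff N_def I_def)
  next
    show "\<forall>m\<ge>1. \<exists>r\<ge>1. \<forall>j. t j \<le> real r * \<alpha> (N j) + \<beta> (I j) / real m"
    proof (intro allI impI)
      fix m :: nat assume m: "m \<ge> 1"
      \<comment> \<open>\<open>R k\<close> is the factor of \<alpha> that suffices for the indices
        attached to k. A sum of these nonnegative numbers over k \<le> m dominates each of them, so
        a single r serves all k \<le> m.\<close>
      define R where "R k = real (S k) + 1 + \<bar>B k\<bar>" for k
      define r where "r = nat \<lceil>\<Sum>k\<le>m. R k\<rceil> + 1"
      have R_le: "R k \<le> real r" if "k \<le> m" for k
      proof -
        have "R k \<le> (\<Sum>k\<le>m. R k)"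
          using that by (intro member_le_sum) (auto simp: R_def)
        also have "\<dots> \<le> real r"
          unfolding r_def by linarith
        finally show ?thesis .
      qed
      have "t j \<le> real r * \<alpha> (N j) + \<beta> (I j) / real m" for j
      proof (cases "\<kappa> j \<le> m")
        case True
        have "\<beta> (I j) / real (\<kappa> j) \<le> \<beta> (I j)"
          using \<beta>_nonneg[of j] \<kappa>_pos[of j] by (simp add: divide_le_eq mult_le_cancel_left1)
        also have "\<dots> \<le> \<bar>B (\<kappa> j)\<bar> * \<alpha> (N j)"
          using B[of j] \<alpha>_nonneg[of j] by (meson abs_ge_self mult_right_mono order_trans)
        finally have "t j \<le> R (\<kappa> j) * \<alpha> (N j)"
          by (simp add: t_def R_def algebra_simps)
        also have "\<dots> \<le> real r * \<alpha> (N j)"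
          using R_le[OF True] \<alpha>_nonneg by (intro mult_right_mono)
        finally show ?thesis
          using \<beta>_nonneg[of j] by (smt (verit) divide_nonneg_nonneg of_nat_0_le_iff)
      next
        case False
        define k where "k = \<kappa> j"
        have k: "real m + 1 \<le> real k" "real m \<ge> 1" using False m by (auto simp: k_def)
        \<comment> \<open>From k - m \<ge> 1 follows k (k - m) \<ge> k \<ge> m; division by m k^2
          gives \<open>gap\<close>.\<close>
        have "real k * 1 \<le> real k * (real k - real m)"
          using k by (intro mult_left_mono) auto
        then have "real m \<le> real k * (real k - real m)"
          using k by linarith
        then have gap: "1 / (real k)\<^sup>2 \<le> 1 / real m - 1 / real k"
          using k by (simp add: field_simps power2_eq_square)
        have "(real (S k) + 1) * \<alpha> (N j) \<le> \<beta> (I j) * (1 / (real k)\<^sup>2)"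
          using A[of j] k by (simp add: A_def k_def[symmetric] field_simps)
        also have "\<dots> \<le> \<beta> (I j) * (1 / real m - 1 / real k)"
          using gap \<beta>_nonneg by (intro mult_left_mono)
        finally have "t j \<le> \<beta> (I j) / real m"
          by (simp add: t_def k_def[symmetric] algebra_simps)
        then show ?thesis
          using \<alpha>_nonneg[of j] by (smt (verit) mult_nonneg_nonneg of_nat_0_le_iff)
      qed
      then show "\<exists>r\<ge>1. \<forall>j. t j \<le> real r * \<alpha> (N j) + \<beta> (I j) / real m"
        by (intro exI[of _ r]) (auto simp: r_def)
    qed
  next
    show "\<forall>k\<ge>1. \<forall>M. \<exists>j. M \<le> \<alpha> (N j) \<and> 0 \<le> \<alpha> (N j) \<and>
           t j = (real (S k) + 1) * \<alpha> (N j) + \<beta> (I j) / real k"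
    proof (intro allI impI)
      fix k :: nat and M :: real assume k: "k \<ge> 1"
      define l where "l = nat \<lceil>M\<rceil>"
      \<comment> \<open>The code of a pair is at least its second component, so j is attached to k
        and also satisfies j \<ge> l \<ge> M.\<close>
      define j where "j = prod_encode (k - 1, l)"
      have "\<kappa> j = k" using k by (simp add: \<kappa>_def j_def)
      moreover have "M \<le> real j"
        using le_prod_encode_2[of l "k - 1"] unfolding j_def l_def by linarith
      ultimately show "\<exists>j. M \<le> \<alpha> (N j) \<and> 0 \<le> \<alpha> (N j) \<and>
             t j = (real (S k) + 1) * \<alpha> (N j) + \<beta> (I j) / real k"
        using \<alpha>_ge[of j] \<alpha>_nonneg[of j] by (intro exI[of _ j]) (auto simp: t_def)
    qed
  qed
qed

section \<open>The topology of a graded space and a continuity criterion\<close>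

lemma topspace_gtopology:
  assumes "\<And>x. x \<in> gcarrier E \<Longrightarrow> gseminorm E 1 (x - x) = 0"
  shows "topspace (gtopology E) = gcarrier E"
proof
  show "topspace (gtopology E) \<subseteq> gcarrier E"
    by (auto simp: gtopology_def)
  show "gcarrier E \<subseteq> topspace (gtopology E)"
  proof
    fix x assume x: "x \<in> gcarrier E"
    have "x \<in> {y \<in> gcarrier E. gseminorm E 1 (y - x) < 1}"
      using x assms by simp
    then show "x \<in> topspace (gtopology E)"
      unfolding gtopology_def topology_generated_by_topspace using x zero_less_one by blast
  qed
qed

text \<open>The record carries no seminorm axioms, so the instances required enter as hypotheses.
  Preimages of subbasic semiballs are shown open; the bound concerns differences, so linearity does
  not enter.\<close>

lemma continuous_map_gtopologyI:
  assumes E0: "\<And>k x. x \<in> gcarrier E \<Longrightarrow> k \<ge> 1 \<Longrightarrow> gseminorm E k (x - x) = 0"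
    and F0: "\<And>x. x \<in> gcarrier F \<Longrightarrow> gseminorm F 1 (x - x) = 0"
    and tri: "\<And>k x y z. \<lbrakk>k \<ge> 1; x \<in> gcarrier F; y \<in> gcarrier F; z \<in> gcarrier F\<rbrakk> \<Longrightarrow>
      gseminorm F k (x - z) \<le> gseminorm F k (x - y) + gseminorm F k (y - z)"
    and T: "\<And>x. x \<in> gcarrier E \<Longrightarrow> T x \<in> gcarrier F"
    and bound: "\<And>k. k \<ge> 1 \<Longrightarrow> \<exists>r\<ge>1. \<forall>x\<in>gcarrier E. \<forall>y\<in>gcarrier E.
      gseminorm F k (T x - T y) \<le> gseminorm E r (x - y)"
  shows "continuous_map (gtopology E) (gtopology F) T"
proof -
  have top: "topspace (gtopology E) = gcarrier E" "topspace (gtopology F) = gcarrier F"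
    using E0 F0 by (simp_all add: topspace_gtopology)
  have "openin (gtopology E) (T -` {y \<in> gcarrier F. gseminorm F k (y - x) < e} \<inter> gcarrier E)"
      (is "openin _ ?U") if x: "x \<in> gcarrier F" and k: "k \<ge> 1" for x k e
  proof (subst openin_subopen, intro ballI)
    fix u assume u: "u \<in> ?U"
    obtain r where r: "r \<ge> 1" "\<And>v w. v \<in> gcarrier E \<Longrightarrow> w \<in> gcarrier E \<Longrightarrow>
        gseminorm F k (T v - T w) \<le> gseminorm E r (v - w)"
      using bound[OF k] by blast
    \<comment> \<open>The slack between T u and the edge of the semiball about x serves as the
      radius of a semiball about u.\<close>
    define d where "d = e - gseminorm F k (T u - x)"
    define V where "V = {v \<in> gcarrier E. gseminorm E r (v - u) < d}"
    have "d > 0" using u by (simp add: d_def)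
    then have "openin (gtopology E) V"
      unfolding gtopology_def V_def using u r(1) by (intro topology_generated_by_Basis) blast
    moreover have "u \<in> V" using u \<open>d > 0\<close> E0[of u r] r(1) by (simp add: V_def)
    moreover have "V \<subseteq> ?U"
    proof
      fix v assume v: "v \<in> V"
      have "gseminorm F k (T v - x) \<le> gseminorm F k (T v - T u) + gseminorm F k (T u - x)"
        using v u x k T by (intro tri) (auto simp: V_def)
      also have "\<dots> < e"
        using v u r(2)[of v u] by (auto simp: V_def d_def)
      finally show "v \<in> ?U" using v T by (auto simp: V_def)
    qed
    ultimately show "\<exists>V. openin (gtopology E) V \<and> u \<in> V \<and> V \<subseteq> ?U" by blast
  qed
  moreover have "T ` gcarrier E \<subseteq> \<Union> {{y \<in> gcarrier F. gseminorm F k (y - x) < e} | x k e.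
      x \<in> gcarrier F \<and> 1 \<le> k \<and> 0 < e}"
    using T top(2) by (auto simp: gtopology_def)
  ultimately show ?thesis
    unfolding gtopology_def[of F] by (intro continuous_on_generated_topo) (auto simp: top(1))
qed

section \<open>Weighted sums of norms and unit sequences\<close>

lemma summable_weighted_norm_diff:
  fixes x y :: "nat \<Rightarrow> 'k::real_normed_field" and w :: "nat \<Rightarrow> real"
  assumes w: "\<And>n. w n \<ge> 0"
    and xy: "summable (\<lambda>n. norm (x n) * w n)" "summable (\<lambda>n. norm (y n) * w n)"
  shows "summable (\<lambda>n. norm ((x - y) n) * w n)"
  by (rule summable_comparison_test'[OF summable_add[OF xy], of 0])
    (use w in \<open>simp add: abs_mult norm_triangle_ineq4 mult_right_mono flip: distrib_right\<close>)

lemma suminf_weighted_norm_triangle: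
  fixes x y z :: "nat \<Rightarrow> 'k::real_normed_field" and w :: "nat \<Rightarrow> real"
  assumes w: "\<And>n. w n \<ge> 0"
    and "summable (\<lambda>n. norm (x n) * w n)" "summable (\<lambda>n. norm (y n) * w n)"
      "summable (\<lambda>n. norm (z n) * w n)"
  shows "(\<Sum>n. norm ((x - z) n) * w n) \<le>
    (\<Sum>n. norm ((x - y) n) * w n) + (\<Sum>n. norm ((y - z) n) * w n)"
proof -
  note diff = summable_weighted_norm_diff[OF w]
  have "(\<Sum>n. norm ((x - z) n) * w n) \<le>
      (\<Sum>n. norm ((x - y) n) * w n + norm ((y - z) n) * w n)"
    using w
    by (intro suminf_le summable_add diff assms)
      (auto intro!: mult_right_mono norm_diff_triangle_le simp flip: distrib_right)
  also have "\<dots> = (\<Sum>n. norm ((x - y) n) * w n) + (\<Sum>n. norm ((y - z) n) * w n)"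
    by (intro suminf_add[symmetric] diff assms)
  finally show ?thesis .
qed

lemma power_series_seminorm_unit:
  "gseminorm (power_series_infinite \<alpha>) r (\<lambda>n. if n = p then c else 0) = norm c * exp (real r * \<alpha> p)"
  "gseminorm (power_series_finite \<beta>) k (\<lambda>n. if n = p then c else 0) = norm c * exp (- \<beta> p / real k)"
  unfolding power_series_infinite_def power_series_finite_def graded_space.simps
  by (subst suminf_finite[where N = "{p}"]; simp)+

lemma unit_in_power_series_infinite:
  "(\<lambda>n. if n = p then c else 0) \<in> gcarrier (power_series_infinite \<alpha>)"
  unfolding power_series_infinite_def by (auto intro!: summable_finite[of "{p}"] split: if_splits)

section \<open>The operator and its continuity\<close>

text \<open>For injective N and I this sends e_(N j) to exp(t j) e_(I j) and every other unit
  sequence to 0. The coordinatewise form is defined on all sequences, without a convergence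
  question.\<close>

definition weighted_shift ::
  "(nat \<Rightarrow> nat) \<Rightarrow> (nat \<Rightarrow> nat) \<Rightarrow> (nat \<Rightarrow> real) \<Rightarrow> (nat \<Rightarrow> 'k) \<Rightarrow> nat \<Rightarrow> 'k::real_normed_field"
where
  "weighted_shift N I t x i =
     (if i \<in> range I then of_real (exp (t (inv I i))) * x (N (inv I i)) else 0)"

lemma weighted_shift_image: "inj I \<Longrightarrow> weighted_shift N I t x (I j) = of_real (exp (t j)) * x (N j)"
  by (simp add: weighted_shift_def)

lemma weighted_shift_outside: "i \<notin> range I \<Longrightarrow> weighted_shift N I t x i = 0"
  by (simp add: weighted_shift_def)

lemma weighted_shift_diff:
  "weighted_shift N I t (x - y) = weighted_shift N I t x - weighted_shift N I t y"
  by (simp add: fun_eq_iff weighted_shift_def algebra_simps)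

lemma weighted_shift_unit:
  assumes "inj N" "inj I"
  shows "weighted_shift N I t (\<lambda>n. if n = N j then c else 0) =
    (\<lambda>i. if i = I j then of_real (exp (t j)) * c else 0)"
  using assms by (auto simp: fun_eq_iff weighted_shift_def inj_eq)

text \<open>The term of the image at I j is at most the term of x at N j. Off the range of I the
  image vanishes, and off the range of N only nonnegative terms of x are dropped.\<close>

lemma weighted_shift_bound:
  fixes x :: "nat \<Rightarrow> 'k::real_normed_field"
  assumes N: "strict_mono N" and I: "strict_mono I"
    and t: "\<forall>j. t j \<le> real r * \<alpha> (N j) + \<beta> (I j) / real m"
    and x: "summable (\<lambda>n. norm (x n) * exp (real r * \<alpha> n))"
  shows "summable (\<lambda>i. norm (weighted_shift N I t x i) * exp (- \<beta> i / real m))"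
    and "(\<Sum>i. norm (weighted_shift N I t x i) * exp (- \<beta> i / real m)) \<le>
      (\<Sum>n. norm (x n) * exp (real r * \<alpha> n))"
proof -
  define f where "f i = norm (weighted_shift N I t x i) * exp (- \<beta> i / real m)" for i
  define g where "g n = norm (x n) * exp (real r * \<alpha> n)" for n
  have g: "summable g" "g n \<ge> 0" for n using x unfolding g_def by simp_all
  have injN: "inj N" using N by (rule strict_mono_imp_inj_on)
  have f0: "f i = 0" if "i \<notin> range I" for i
    using that by (simp add: f_def weighted_shift_outside)
  have fg: "f (I j) \<le> g (N j)" for j
  proof -
    have "f (I j) = norm (x (N j)) * exp (t j - \<beta> (I j) / real m)"
      using strict_mono_imp_inj_on[OF I]
      by (simp add: f_def weighted_shift_image norm_mult exp_diff exp_minus field_simps)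
    also have "\<dots> \<le> g (N j)"
      unfolding g_def using spec[OF t, of j] by (intro mult_left_mono) auto
    finally show ?thesis .
  qed
  have gN: "summable (\<lambda>j. g (N j))"
    using summable_reindex[OF g(1) injN g(2)] by (simp add: o_def)
  have fI: "summable (\<lambda>j. f (I j))"
    by (rule summable_comparison_test'[OF gN, of 0]) (use fg in \<open>simp add: f_def\<close>)
  then show "summable f"
    using summable_mono_reindex[OF I, of f] f0 by simp
  have "suminf f = (\<Sum>j. f (I j))"
    using suminf_mono_reindex[OF I, of f] f0 by simp
  also have "\<dots> \<le> (\<Sum>j. g (N j))"
    using fg fI gN by (rule suminf_le)
  also have "\<dots> \<le> suminf g"
    using suminf_reindex_mono[OF g(1) injN g(2)] by (simp add: o_def)
  finally show "suminf f \<le> suminf g" .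
qed

lemma continuous_linear_operator_weighted_shift:
  fixes \<alpha> \<beta> :: "nat \<Rightarrow> real"
  assumes N: "strict_mono N" and I: "strict_mono I"
    and t: "\<forall>m\<ge>1. \<exists>r\<ge>1. \<forall>j. t j \<le> real r * \<alpha> (N j) + \<beta> (I j) / real m"
  shows "continuous_linear_operator
    (power_series_infinite \<alpha> :: ('k::{real_normed_field,banach}, nat \<Rightarrow> 'k) graded_space)
    (power_series_finite \<beta>) (weighted_shift N I t)"
    (is "continuous_linear_operator ?E ?F ?T")
proof -
  have summable_diff: "summable (\<lambda>n. norm ((x - y) n) * exp (real r * \<alpha> n))"
    if "x \<in> gcarrier ?E" "y \<in> gcarrier ?E" "r \<ge> 1" for x y r
    using that by (intro summable_weighted_norm_diff) (auto simp: power_series_infinite_def)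
  have "glinear ?E ?F ?T"
    by (auto simp: glinear_def weighted_shift_def power_series_infinite_def
        power_series_finite_def fun_eq_iff algebra_simps)
  moreover have "continuous_map (gtopology ?E) (gtopology ?F) ?T"
  proof (rule continuous_map_gtopologyI)
    show "?T x \<in> gcarrier ?F" if x: "x \<in> gcarrier ?E" for x
    proof -
      have "summable (\<lambda>i. norm (?T x i) * exp (- \<beta> i / real m))" if m: "m \<ge> 1" for m
      proof -
        obtain r where r: "r \<ge> 1" "\<forall>j. t j \<le> real r * \<alpha> (N j) + \<beta> (I j) / real m"
          using t[rule_format, OF m] by blast
        show ?thesis
          using x r(1) by (intro weighted_shift_bound(1)[OF N I r(2)])
            (auto simp: power_series_infinite_def)
      qed
      then show ?thesis by (simp add: power_series_finite_def)
    qed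
    show "\<exists>r\<ge>1. \<forall>x\<in>gcarrier ?E. \<forall>y\<in>gcarrier ?E.
        gseminorm ?F m (?T x - ?T y) \<le> gseminorm ?E r (x - y)" if m: "m \<ge> 1" for m
    proof -
      obtain r where r: "r \<ge> 1" "\<forall>j. t j \<le> real r * \<alpha> (N j) + \<beta> (I j) / real m"
        using t[rule_format, OF m] by blast
      have "gseminorm ?F m (?T x - ?T y) \<le> gseminorm ?E r (x - y)"
        if "x \<in> gcarrier ?E" "y \<in> gcarrier ?E" for x y
        using weighted_shift_bound(2)[OF N I r(2) summable_diff[OF that r(1)]]
        unfolding power_series_infinite_def power_series_finite_def graded_space.simps
          weighted_shift_diff .
      with r(1) show ?thesis by blast
    qed
    show "gseminorm ?F k (x - z) \<le> gseminorm ?F k (x - y) + gseminorm ?F k (y - z)"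
      if "k \<ge> 1" "x \<in> gcarrier ?F" "y \<in> gcarrier ?F" "z \<in> gcarrier ?F" for k x y z
      unfolding power_series_finite_def graded_space.simps
      using that by (intro suminf_weighted_norm_triangle) (auto simp: power_series_finite_def)
  qed (simp_all add: power_series_infinite_def power_series_finite_def)
  ultimately show ?thesis
    by (simp add: continuous_linear_operator_def)
qed

section \<open>Refutation of an arbitrary candidate \<open>S\<close>\<close>

theorem theorem4p5:
  fixes \<alpha> \<beta> :: "nat \<Rightarrow> real"
  assumes "incseq \<alpha>" and "filterlim \<alpha> at_top sequentially"
    and "incseq \<beta>" and "filterlim \<beta> at_top sequentially"
    and "stable_seq \<alpha> \<or> stable_seq \<beta>"
  shows "\<not> tame_pair
    (power_series_infinite \<alpha> :: ('k::{real_normed_field,banach}, nat \<Rightarrow> 'k) graded_space)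
    (power_series_finite \<beta>)"
    (is "\<not> tame_pair ?E ?F")
proof
  assume "tame_pair ?E ?F"
  then obtain S :: "nat \<Rightarrow> nat" where S: "\<And>T. continuous_linear_operator ?E ?F T \<Longrightarrow>
      \<forall>\<^sub>F k in sequentially. char_of_continuity ?E ?F T k \<le> enat (S k)"
    unfolding tame_pair_def by blast
  obtain N I :: "nat \<Rightarrow> nat" and t :: "nat \<Rightarrow> real"
    where N: "strict_mono N" and I: "strict_mono I"
    and t: "\<forall>m\<ge>1. \<exists>r\<ge>1. \<forall>j. t j \<le> real r * \<alpha> (N j) + \<beta> (I j) / real m"
    and t_eq: "\<forall>k\<ge>1. \<forall>M. \<exists>j. M \<le> \<alpha> (N j) \<and> 0 \<le> \<alpha> (N j) \<and>
           t j = (real (S k) + 1) * \<alpha> (N j) + \<beta> (I j) / real k"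
    using exponents_with_prescribed_growth[OF assms, of S] .
  define T :: "(nat \<Rightarrow> 'k) \<Rightarrow> nat \<Rightarrow> 'k" where "T = weighted_shift N I t"
  have "\<forall>\<^sub>F k in sequentially. char_of_continuity ?E ?F T k \<le> enat (S k) \<and> k \<ge> 1"
    unfolding T_def
    by (intro eventually_conj S continuous_linear_operator_weighted_shift N I t
        eventually_ge_at_top)
  then obtain k where k: "k \<ge> 1" and "char_of_continuity ?E ?F T k \<le> enat (S k)"
    by (auto dest!: eventually_happens)
  \<comment> \<open>A strict bound on an infimum yields a member below it, and r < S k + 1 is r
    \<le> S k.\<close>
  then have "char_of_continuity ?E ?F T k < enat (Suc (S k))"
    by (metis enat_ord_simps(2) lessI order_le_less_trans)
  then obtain r where r: "r \<le> S k"
    and "bdd_above ((\<lambda>x. gseminorm ?F k (T x)) ` {x \<in> gcarrier ?E. gseminorm ?E r x \<le> 1})"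
    unfolding char_of_continuity_def INF_less_iff by (auto simp: less_Suc_eq_le)
  then obtain C where C: "\<And>x. x \<in> gcarrier ?E \<Longrightarrow> gseminorm ?E r x \<le> 1 \<Longrightarrow> gseminorm ?F k (T x) \<le> C"
    unfolding bdd_above_def by blast
  \<comment> \<open>The supposed bound C itself is the threshold for \<alpha>, aiming at C \<le>
    \<alpha>_(N j) < exp(\<alpha>_(N j)) \<le> C.\<close>
  obtain j where j: "C \<le> \<alpha> (N j)" "0 \<le> \<alpha> (N j)"
      "t j = (real (S k) + 1) * \<alpha> (N j) + \<beta> (I j) / real k"
    using t_eq[rule_format, OF k] by blast
  \<comment> \<open>A multiple of e_(N j) scaled to have r-th seminorm exactly 1.\<close>
  define x :: "nat \<Rightarrow> 'k" where
    "x = (\<lambda>n. if n = N j then of_real (exp (- (real r * \<alpha> (N j)))) else 0)"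
  have "gseminorm ?F k (T x) \<le> C"
    unfolding x_def by (intro C unit_in_power_series_infinite)
      (simp add: power_series_seminorm_unit flip: exp_add)
  moreover have "gseminorm ?F k (T x) =
      exp (t j) * exp (- (real r * \<alpha> (N j))) * exp (- \<beta> (I j) / real k)"
    unfolding x_def T_def
    unfolding weighted_shift_unit[OF N[THEN strict_mono_imp_inj_on] I[THEN strict_mono_imp_inj_on]]
    by (simp add: power_series_seminorm_unit norm_mult)
  \<comment> \<open>The summand \<beta>/k of t j cancels the weight of the k-th seminorm. As r \<le>
    S k, the extra 1 in S k + 1 leaves at least one full \<alpha>_(N j) in the exponent.\<close>
  moreover have "\<dots> = exp ((real (S k) + 1 - real r) * \<alpha> (N j))"
    by (simp add: j(3) algebra_simps flip: exp_add)
  moreover have "\<alpha> (N j) < exp (1 * \<alpha> (N j))"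
    using exp_ge_add_one_self[of "\<alpha> (N j)"] unfolding mult_1 by linarith
  moreover have "exp (1 * \<alpha> (N j)) \<le> exp ((real (S k) + 1 - real r) * \<alpha> (N j))"
    unfolding exp_le_cancel_iff using r j(2) by (intro mult_right_mono) auto
  ultimately show False
    using j(1) by linarith
qed

end
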